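(* The Lüroth map $\mathcal{L}:[0,1]\to[0,1]$ is Devaney chaotic.
   Context: For $x\in(0,1]$, $a_1(x)$ is the unique integer $\ge 2$ with $\frac{1}{a_1(x)}<x\le\frac{1}{a_1(x)-1}$. The Lüroth map $\mathcal{L}:[0,1]\to[0,1]$ is $\mathcal{L}(x)=a_1(x)(a_1(x)-1)x-(a_1(x)-1)$ for $x\in(0,1]$ and $\mathcal{L}(0)=0$. Let $X$ be a metric space with metric $d$ and $f:X\to X$ a map (not necessarily continuous). $(X,f)$ is Devaney chaotic if: (a) it is topologically transitive: for all non-empty open $U,V\subseteq X$ there is $n\in\mathbb{N}$ with $f^n[U]\cap V\ne\varnothing$; (b) the set of periodic points (points $x$ with $f^n(x)=x$ for some $n\in\mathbb{N}$, $n\geq 1$) is dense in $X$; (c) it is sensitive to initial conditions: there is $\varepsilon>0$ such that for all $x\in X$ and all $\delta>0$ there are $y\in X$ with $d(x,y)<\delta$ and $n\in\mathbb{N}$ with $d(f^n(x),f^n(y))\ge\varepsilon$. Here $X=[0,1]$ with the usual metric and $f=\mathcal{L}$. *)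

theory Defs
  imports "HOL-Analysis.Analysis"
begin

(* Devaney chaos for a self-map f of a metric space X, where X is a subset of a metric-space
   type with the restricted metric. The open sets of X are the relatively open ones, and the
   natural numbers include 0. *)

definition topologically_transitive_on :: "'a::metric_space set \<Rightarrow> ('a \<Rightarrow> 'a) \<Rightarrow> bool" where
  "topologically_transitive_on X f \<longleftrightarrow>
     (\<forall>U V. openin (top_of_set X) U \<and> U \<noteq> {} \<and> openin (top_of_set X) V \<and> V \<noteq> {} \<longrightarrow>
        (\<exists>n::nat. (f ^^ n) ` U \<inter> V \<noteq> {}))"

definition periodic_points_on :: "'a set \<Rightarrow> ('a \<Rightarrow> 'a) \<Rightarrow> 'a set" where
  "periodic_points_on X f = {x \<in> X. \<exists>n::nat. n \<ge> 1 \<and> (f ^^ n) x = x}"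

definition sensitive_on :: "'a::metric_space set \<Rightarrow> ('a \<Rightarrow> 'a) \<Rightarrow> bool" where
  "sensitive_on X f \<longleftrightarrow>
     (\<exists>\<epsilon>>0. \<forall>x\<in>X. \<forall>\<delta>>0. \<exists>y\<in>X. dist x y < \<delta> \<and>
        (\<exists>n::nat. dist ((f ^^ n) x) ((f ^^ n) y) \<ge> \<epsilon>))"

definition devaney_chaotic_on :: "'a::metric_space set \<Rightarrow> ('a \<Rightarrow> 'a) \<Rightarrow> bool" where
  "devaney_chaotic_on X f \<longleftrightarrow>
     f \<in> X \<rightarrow> X \<and>
     topologically_transitive_on X f \<and>
     X \<subseteq> closure (periodic_points_on X f) \<and>
     sensitive_on X f"

definition luroth_digit :: "real \<Rightarrow> int" where
  "luroth_digit x = (THE a. a \<ge> 2 \<and> 1 / of_int a < x \<and> x \<le> 1 / (of_int a - 1))"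

(* Only the values on the unit interval matter. *)
definition luroth_map :: "real \<Rightarrow> real" where
  "luroth_map x =
     (if x = 0 then 0
      else of_int (luroth_digit x) * (of_int (luroth_digit x) - 1) * x
             - (of_int (luroth_digit x) - 1))"

lemma luroth_digit_ex1:
  fixes x :: real
  assumes "0 < x" "x \<le> 1"
  shows "\<exists>!a::int. a \<ge> 2 \<and> 1 / of_int a < x \<and> x \<le> 1 / (of_int a - 1)"
proof -
  have eq: "(a \<ge> 2 \<and> 1 / of_int a < x \<and> x \<le> 1 / (of_int a - 1)) \<longleftrightarrow> a = \<lfloor>1 / x\<rfloor> + 1"
    for a :: int
  proof (cases "a \<ge> 2")
    case True
    then have a: "(of_int a :: real) \<ge> 2" by linarith
    have "1 / of_int a < x \<longleftrightarrow> 1 / x < of_int a"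
      using a assms by (simp add: field_simps)
    moreover have "x \<le> 1 / (of_int a - 1) \<longleftrightarrow> of_int a - 1 \<le> 1 / x"
      using a assms by (simp add: field_simps)
    ultimately show ?thesis using True by linarith
  next
    case False
    have "1 / x \<ge> 1" using assms by simp
    then have "\<lfloor>1 / x\<rfloor> \<ge> 1" by linarith
    then show ?thesis using False by linarith
  qed
  show ?thesis unfolding eq by simp
qed

end

(* The Lueroth map sends each interval (1/a, 1/(a-1)] affinely onto (0,1], with slope a(a-1) >= 2.
   Composing inverse branches, every point of (0,1] lies in arbitrarily small intervals (u, u+s] on
   which some iterate is the affine bijection u + s y |-> y onto (0,1]. This full-branch property
   gives all three parts of Devaney chaos: the image of a small interval meets every open set, the
   fixed point u/(1-s) of the inverse branch is periodic, and a small interval contains points that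
   are sent to 1/2 and to 1. *)

theory Submission
  imports Defs
begin

lemma luroth_digit_eq:
  assumes "a \<ge> 2" "1 / of_int a < x" "x \<le> 1 / (of_int a - 1)"
  shows "luroth_digit x = a"
proof -
  have "0 < 1 / real_of_int a" "1 / (real_of_int a - 1) \<le> 1"
    using assms(1) by simp_all
  then have "0 < x" "x \<le> 1"
    using assms(2,3) by linarith+
  then show ?thesis
    unfolding luroth_digit_def using luroth_digit_ex1[of x] assms by (intro the1_equality) auto
qed

lemma luroth_digit_bounds:
  assumes "0 < x" "x \<le> 1"
  shows "luroth_digit x \<ge> 2" "1 / of_int (luroth_digit x) < x"
    "x \<le> 1 / (of_int (luroth_digit x) - 1)"
  using theI'[OF luroth_digit_ex1[OF assms]] unfolding luroth_digit_def by auto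

text \<open>Since \<open>0\<close> is excluded from the image, the next digit is again well defined;
  this is what lets the induction over iterates continue.\<close>

lemma luroth_map_range:
  assumes "0 < x" "x \<le> 1"
  shows "0 < luroth_map x" "luroth_map x \<le> 1"
proof -
  define a where "a = real_of_int (luroth_digit x)"
  have a: "a \<ge> 2" "1 / a < x" "x \<le> 1 / (a - 1)"
    using luroth_digit_bounds[OF assms] unfolding a_def by auto
  \<comment> \<open>In this factored form positivity is exactly \<open>1 / a < x\<close>.\<close>
  have eq: "luroth_map x = (a - 1) * (a * x - 1)"
    using assms unfolding luroth_map_def a_def by (simp add: algebra_simps)
  have "a * x - 1 > 0"
    using a by (simp add: field_simps)
  then show "0 < luroth_map x"
    using a unfolding eq by simp
  have "a * ((a - 1) * x) \<le> a * 1"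
    using a by (intro mult_left_mono) (simp_all add: field_simps)
  then show "luroth_map x \<le> 1"
    unfolding eq by (simp add: algebra_simps)
qed

text \<open>For \<open>y\<close> in (0,1] the numerator lies in (a-1, a], so the quotient lies in
  (1/a, 1/(a-1)]. Its digit is therefore \<open>a\<close>, and the affine formula can be
  inverted.\<close>

lemma luroth_map_inverse_branch:
  assumes "a \<ge> 2" "0 < y" "y \<le> 1"
  shows "luroth_map ((y + (of_int a - 1)) / (of_int a * (of_int a - 1))) = y"
proof -
  define A where "A = real_of_int a"
  define x where "x = (y + (A - 1)) / (A * (A - 1))"
  have A: "A \<ge> 2"
    using assms(1) unfolding A_def by simp
  have "(A - 1) / (A * (A - 1)) < x" "x \<le> A / (A * (A - 1))"
    using A assms(2,3) unfolding x_def
    by (intro divide_strict_right_mono divide_right_mono mult_pos_pos mult_nonneg_nonneg; simp)+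
  then have "1 / A < x" "x \<le> 1 / (A - 1)"
    using A by auto
  moreover have "x > 0"
    using A assms(2) unfolding x_def by (intro divide_pos_pos mult_pos_pos) auto
  moreover from calculation have "luroth_digit x = a"
    using assms(1) unfolding A_def by (intro luroth_digit_eq) auto
  ultimately have "luroth_map x = A * (A - 1) * x - (A - 1)"
    unfolding luroth_map_def A_def by simp
  also have "\<dots> = y"
    using A unfolding x_def by simp
  finally show ?thesis
    unfolding x_def A_def .
qed

text \<open>The strict bound \<open>u > 0\<close> for \<open>n > 0\<close> keeps the fixed point of the inverse branch away
  from \<open>0\<close>, where the branch is not defined.\<close>

lemma luroth_full_branch:
  assumes "0 < x" "x \<le> 1"
  shows "\<exists>u s. 0 < s \<and> s \<le> (1/2) ^ n \<and> 0 \<le> u \<and> (n > 0 \<longrightarrow> 0 < u) \<and> u + s \<le> 1 \<and>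
    u < x \<and> x \<le> u + s \<and> (\<forall>y\<in>{0<..1}. (luroth_map ^^ n) (u + s * y) = y)"
  using assms
proof (induction n arbitrary: x)
  case 0
  then show ?case
    by (intro exI[of _ 0] exI[of _ 1]) auto
next
  case (Suc n)
  obtain u s where us: "0 < s" "s \<le> (1/2) ^ n" "0 \<le> u" "u + s \<le> 1"
      "u < luroth_map x" "luroth_map x \<le> u + s"
      and iter: "\<forall>y\<in>{0<..1}. (luroth_map ^^ n) (u + s * y) = y"
    using Suc.IH[OF luroth_map_range[OF Suc.prems]] by blast
  \<comment> \<open>The interval for \<open>x\<close> is the preimage of the one for
    \<open>luroth_map x\<close> under the branch with digit \<open>a\<close>, which has slope
    \<open>D\<close>. Its left end is positive even if \<open>u = 0\<close>, because
    \<open>A - 1 > 0\<close>.\<close>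
  define a where "a = luroth_digit x"
  define A where "A = real_of_int a"
  define D where "D = A * (A - 1)"
  have a: "a \<ge> 2"
    using luroth_digit_bounds[OF Suc.prems] unfolding a_def by simp
  then have A: "A \<ge> 2"
    unfolding A_def by simp
  then have "2 * 1 \<le> D"
    unfolding D_def by (intro mult_mono) auto
  then have D: "D \<ge> 2"
    by simp
  have map_x: "luroth_map x = D * x - (A - 1)"
    using Suc.prems unfolding luroth_map_def D_def A_def a_def by simp
  \<comment> \<open>\<open>A \<le> D\<close> bounds the new right end: \<open>u + s \<le> 1\<close>
    gives \<open>(u + (A - 1) + s) / D \<le> A / D \<le> 1\<close>.\<close>
  have "2 * A \<le> A * A"
    using A by (intro mult_right_mono) auto
  then have "A \<le> D"
    unfolding D_def by (simp add: algebra_simps)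
  have "s / D \<le> s / 2"
    using D us(1) by (intro divide_left_mono) auto
  then have "s / D \<le> (1/2) ^ Suc n"
    using us(2) by simp
  moreover have "0 < (u + (A - 1)) / D" "(u + (A - 1)) / D + s / D \<le> 1"
    using us A D \<open>A \<le> D\<close> by (auto simp: field_simps)
  moreover have "(u + (A - 1)) / D < x" "x \<le> (u + (A - 1)) / D + s / D"
    using us(5,6) D unfolding map_x by (auto simp: field_simps)
  moreover have "(luroth_map ^^ Suc n) ((u + (A - 1)) / D + s / D * y) = y"
    if "0 < y" "y \<le> 1" for y
  proof -
    have "s * y \<le> s * 1"
      using that us(1) by (intro mult_left_mono) auto
    then have "0 < u + s * y" "u + s * y \<le> 1"
      using that us(1,3,4) by (simp add: add_nonneg_pos, linarith)
    then have "luroth_map ((u + s * y + (A - 1)) / D) = u + s * y"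
      using luroth_map_inverse_branch[OF a] unfolding D_def A_def by blast
    moreover have "(u + (A - 1)) / D + s / D * y = (u + s * y + (A - 1)) / D"
      by (simp add: add_divide_distrib diff_divide_distrib)
    ultimately show ?thesis
      using iter that by (simp add: funpow_Suc_right del: funpow.simps)
  qed
  moreover have "0 < s / D"
    using us(1) D by simp
  ultimately show ?case
    by (intro exI[of _ "(u + (A - 1)) / D"] exI[of _ "s / D"]) auto
qed

text \<open>No branch interval contains \<open>0\<close>, but some come arbitrarily close to it, so
  replacing \<open>z\<close> by a nearby positive point extends the full-branch property to all of
  [0,1].\<close>

lemma luroth_full_branch_near:
  assumes "z \<in> {0..1}" "\<delta> > 0"
  obtains n u s where "n \<ge> 1" "0 < s" "s < 1" "0 < u" "u + s \<le> 1"
    "\<And>y. 0 < y \<Longrightarrow> y \<le> 1 \<Longrightarrow> u + s * y \<in> {0<..1}"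
    "\<And>y. 0 < y \<Longrightarrow> y \<le> 1 \<Longrightarrow> dist z (u + s * y) < \<delta>"
    "\<And>y. 0 < y \<Longrightarrow> y \<le> 1 \<Longrightarrow> (luroth_map ^^ n) (u + s * y) = y"
proof -
  \<comment> \<open>Moving to \<open>x\<close> costs at most \<open>\<delta> / 3\<close>. Both
    \<open>x\<close> and \<open>u + s * y\<close> lie in (u, u+s], which costs less than another
    \<open>\<delta> / 3\<close>.\<close>
  define x where "x = max z (min 1 (\<delta> / 3))"
  have x: "0 < x" "x \<le> 1" "\<bar>x - z\<bar> \<le> \<delta> / 3"
    using assms unfolding x_def by auto
  obtain m where m: "(1/2 :: real) ^ m < \<delta> / 3"
    using real_arch_pow_inv[of "\<delta> / 3" "1/2"] assms(2) by auto
  \<comment> \<open>The exponent \<open>Suc m\<close> ensures a positive period,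
    \<open>u > 0\<close> and a strict contraction.\<close>
  have small: "(1/2 :: real) ^ Suc m < \<delta> / 3" "(1/2 :: real) ^ Suc m < 1"
  proof -
    have "(1/2 :: real) ^ Suc m \<le> (1/2) ^ m"
      by simp
    then show "(1/2 :: real) ^ Suc m < \<delta> / 3"
      using m by linarith
    show "(1/2 :: real) ^ Suc m < 1"
      by (rule power_Suc_less_one) auto
  qed
  obtain u s where us: "0 < s" "s \<le> (1/2) ^ Suc m" "0 < u" "u + s \<le> 1" "u < x" "x \<le> u + s"
      and iter: "\<forall>y\<in>{0<..1}. (luroth_map ^^ Suc m) (u + s * y) = y"
    using luroth_full_branch[OF x(1,2), of "Suc m"] by blast
  have sy: "0 < s * y" "s * y \<le> s" if "0 < y" "y \<le> 1" for y
    using that us(1) mult_left_mono[of y 1 s] by auto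
  show ?thesis
  proof (rule that[of "Suc m" s u])
    show "s < 1"
      using us(2) small(2) by linarith
    show "u + s * y \<in> {0<..1}" if "0 < y" "y \<le> 1" for y
      using sy[OF that] us(3,4) by simp
    show "dist z (u + s * y) < \<delta>" if "0 < y" "y \<le> 1" for y
      using sy[OF that] us small(1) x(3) unfolding dist_real_def by linarith
  qed (use us iter in auto)
qed

lemma openin_unit_interval_luroth_branch:
  assumes "openin (top_of_set {0..1::real}) U" "U \<noteq> {}"
  shows "\<exists>n u s. \<forall>y\<in>{0<..1}. u + s * y \<in> U \<inter> {0<..1} \<and> (luroth_map ^^ n) (u + s * y) = y"
proof -
  obtain z where z: "z \<in> U" "z \<in> {0..1}"
    using assms openin_imp_subset by blast
  then obtain e where e: "e > 0" "ball z e \<inter> {0..1} \<subseteq> U"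
    using assms(1) unfolding openin_contains_ball by blast
  obtain n u s where "\<And>y. 0 < y \<Longrightarrow> y \<le> 1 \<Longrightarrow> u + s * y \<in> {0<..1}"
    "\<And>y. 0 < y \<Longrightarrow> y \<le> 1 \<Longrightarrow> dist z (u + s * y) < e"
    "\<And>y. 0 < y \<Longrightarrow> y \<le> 1 \<Longrightarrow> (luroth_map ^^ n) (u + s * y) = y"
    using luroth_full_branch_near[OF z(2) e(1)] by metis
  moreover have "t \<in> U" if "t \<in> {0<..1}" "dist z t < e" for t
    using that e(2) by auto
  ultimately have "\<forall>y\<in>{0<..1}. u + s * y \<in> U \<inter> {0<..1} \<and> (luroth_map ^^ n) (u + s * y) = y"
    by simp
  then show ?thesis
    by blast
qed

lemma luroth_topologically_transitive: "topologically_transitive_on {0..1} luroth_map"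
  unfolding topologically_transitive_on_def
proof (intro allI impI, elim conjE)
  fix U V :: "real set"
  assume U: "openin (top_of_set {0..1}) U" "U \<noteq> {}"
    and V: "openin (top_of_set {0..1}) V" "V \<noteq> {}"
  \<comment> \<open>The parameter \<open>1\<close> on a branch inside \<open>V\<close> supplies a
    nonzero target \<open>v\<close>, which a full branch inside \<open>U\<close> must hit.\<close>
  have "(1::real) \<in> {0<..1}"
    by simp
  then obtain v where v: "v \<in> V" "v \<in> {0<..1}"
    using openin_unit_interval_luroth_branch[OF V] by blast
  obtain n u s where "u + s * v \<in> U" "(luroth_map ^^ n) (u + s * v) = v"
    using openin_unit_interval_luroth_branch[OF U] v(2) by blast
  then have "v \<in> (luroth_map ^^ n) ` U"
    by (metis imageI)
  then show "\<exists>n. (luroth_map ^^ n) ` U \<inter> V \<noteq> {}"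
    using v(1) by (intro exI[of _ n]) auto
qed

lemma luroth_periodic_points_dense: "{0..1} \<subseteq> closure (periodic_points_on {0..1} luroth_map)"
proof
  fix z :: real
  assume z: "z \<in> {0..1}"
  show "z \<in> closure (periodic_points_on {0..1} luroth_map)"
    unfolding closure_approachable
  proof (intro allI impI)
    fix e :: real
    assume "e > 0"
    then obtain n u s where n: "n \<ge> 1" and us: "0 < s" "s < 1" "0 < u" "u + s \<le> 1"
      and near: "\<And>y. 0 < y \<Longrightarrow> y \<le> 1 \<Longrightarrow> dist z (u + s * y) < e"
      and iter: "\<And>y. 0 < y \<Longrightarrow> y \<le> 1 \<Longrightarrow> (luroth_map ^^ n) (u + s * y) = y"
      using luroth_full_branch_near[OF z] by metis
    define p where "p = u / (1 - s)"
    \<comment> \<open>The bounds come from \<open>u > 0\<close> and \<open>u + s \<le> 1\<close>;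
      they make \<open>p\<close> an admissible parameter of its own branch.\<close>
    have p: "0 < p" "p \<le> 1" "u + s * p = p"
      using us unfolding p_def by (auto simp: field_simps)
    then have "(luroth_map ^^ n) p = p" "dist p z < e"
      using near[OF p(1,2)] iter[OF p(1,2)] by (auto simp: dist_commute)
    then show "\<exists>y\<in>periodic_points_on {0..1} luroth_map. dist y z < e"
      using n p(1,2) unfolding periodic_points_on_def by (intro bexI[of _ p]) auto
  qed
qed

lemma luroth_sensitive: "sensitive_on {0..1} luroth_map"
  unfolding sensitive_on_def
proof (intro exI[of _ "1/4"] conjI ballI allI impI)
  fix x \<delta> :: real
  assume x: "x \<in> {0..1}" and "\<delta> > 0"
  then obtain n u s where range: "\<And>y. 0 < y \<Longrightarrow> y \<le> 1 \<Longrightarrow> u + s * y \<in> {0<..1}"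
      and near: "\<And>y. 0 < y \<Longrightarrow> y \<le> 1 \<Longrightarrow> dist x (u + s * y) < \<delta>"
      and iter: "\<And>y. 0 < y \<Longrightarrow> y \<le> 1 \<Longrightarrow> (luroth_map ^^ n) (u + s * y) = y"
    using luroth_full_branch_near[OF x] by metis
  define w where "w = (luroth_map ^^ n) x"
  \<comment> \<open>The points 1/2 and 1 are 1/2 apart, so one of them is at least 1/4 away from
    \<open>w\<close>; their midpoint 3/4 decides which.\<close>
  obtain y :: real where y: "0 < y" "y \<le> 1" "dist w y \<ge> 1/4"
  proof (cases "w \<le> 3/4")
    case True
    then show ?thesis
      by (intro that[of 1]) (auto simp: dist_real_def)
  next
    case False
    then show ?thesis
      by (intro that[of "1/2"]) (auto simp: dist_real_def)
  qed
  then have "dist ((luroth_map ^^ n) x) ((luroth_map ^^ n) (u + s * y)) \<ge> 1/4"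
    using iter unfolding w_def by simp
  then show "\<exists>y\<in>{0..1}. dist x y < \<delta> \<and>
      (\<exists>n. dist ((luroth_map ^^ n) x) ((luroth_map ^^ n) y) \<ge> 1/4)"
    using range[OF y(1,2)] near[OF y(1,2)] by (intro bexI[of _ "u + s * y"]) auto
qed simp

theorem theorem3:
  shows "devaney_chaotic_on {0..1} luroth_map"
proof -
  have "luroth_map x \<in> {0..1}" if "x \<in> {0..1}" for x
  proof (cases "x = 0")
    case True
    then show ?thesis
      by (simp add: luroth_map_def)
  next
    case False
    then show ?thesis
      using luroth_map_range[of x] that by auto
  qed
  then show ?thesis
    unfolding devaney_chaotic_on_def
    using luroth_topologically_transitive luroth_periodic_points_dense luroth_sensitive by auto
qed

end
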